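(* Let $\mathcal{X}$ be a finite set with $|\mathcal{X}|\ge3$. Let $\mathcal{W}$ be the set of entrywise positive row-stochastic matrices on $\mathcal{X}$, $\mathcal{W}_{\mathsf{sym}}\subset\mathcal{W}$ the subset of symmetric kernels and $\mathcal{W}_{\mathsf{rev}}\subset\mathcal{W}$ the subset of reversible kernels. Then $$\text{e-hull}(\mathcal{W}_{\mathsf{sym}})=\mathcal{W}_{\mathsf{rev}}.$$
   Context: $P\in\mathcal{W}$ is symmetric if $P=P^{\intercal}$, and reversible if $\pi(x)P(x,x')=\pi(x')P(x',x)$ for all $x,x'$, where $\pi$ is its stationary distribution. For an entrywise positive matrix $\widetilde P$ on $\mathcal{X}$, $\mathfrak{s}(\widetilde P)(x,x')=\frac{\widetilde P(x,x')v(x')}{\rho(\widetilde P)v(x)}$, where $\rho(\widetilde P)$ and $v$ are the Perron–Frobenius root and right Perron–Frobenius eigenvector of $\widetilde P$; then $\mathfrak{s}(\widetilde P)\in\mathcal{W}$. For $\mathcal{V}\subset\mathcal{W}$, the exponential hull is $$\text{e-hull}(\mathcal{V})=\Big\{\mathfrak{s}(\widetilde P):\log[\widetilde P]=\sum_{i=1}^k\alpha_i\log[P_i],\ k\in\mathbb{N},\ \alpha_1,\dots,\alpha_k\in\mathbb{R},\ \sum_{i=1}^k\alpha_i=1,\ P_1,\dots,P_k\in\mathcal{V}\Big\},$$ with $\log[\cdot]$ the entrywise logarithm. *)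

theory Defs
  imports "HOL-Analysis.Analysis"
begin

text \<open>A finite type \<open>'x\<close> plays the role of the state space; entry \<open>(x, x')\<close> of a matrix
  \<open>P :: real^'x^'x\<close> is \<open>P $ x $ x'\<close>.\<close>

definition positive_matrix :: "real^'x^'x \<Rightarrow> bool" where
  "positive_matrix A \<longleftrightarrow> (\<forall>x x'. 0 < A $ x $ x')"

definition kernels :: "(real^'x::finite^'x) set" where
  "kernels = {P. positive_matrix P \<and> (\<forall>x. (\<Sum>x'\<in>UNIV. P $ x $ x') = 1)}"

definition sym_kernels :: "(real^'x::finite^'x) set" where
  "sym_kernels = {P \<in> kernels. P = transpose P}"

definition is_stationary :: "real^'x::finite^'x \<Rightarrow> real^'x \<Rightarrow> bool" where
  "is_stationary P \<pi> \<longleftrightarrow> (\<forall>x. 0 \<le> \<pi> $ x) \<and> (\<Sum>x\<in>UNIV. \<pi> $ x) = 1 \<and> \<pi> v* P = \<pi>"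

text \<open>An entrywise positive kernel has exactly one stationary distribution, so the existential
  quantifier below only names it.\<close>

definition reversible :: "real^'x::finite^'x \<Rightarrow> bool" where
  "reversible P \<longleftrightarrow>
    (\<exists>\<pi>. is_stationary P \<pi> \<and> (\<forall>x x'. \<pi> $ x * P $ x $ x' = \<pi> $ x' * P $ x' $ x))"

definition rev_kernels :: "(real^'x::finite^'x) set" where
  "rev_kernels = {P \<in> kernels. reversible P}"

definition complex_spectrum :: "real^'x::finite^'x \<Rightarrow> complex set" where
  "complex_spectrum A =
    {z. \<exists>u :: complex^'x. u \<noteq> 0 \<and> map_matrix complex_of_real A *v u = z *s u}"

text \<open>The Perron--Frobenius root of a positive matrix is its spectral radius.\<close>

definition pf_root :: "real^'x::finite^'x \<Rightarrow> real" where
  "pf_root A = (SUP z\<in>complex_spectrum A. cmod z)"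

text \<open>By the Perron--Frobenius theorem, for a positive matrix such a vector exists and is unique up
  to a positive scalar factor. The factor chosen is irrelevant for \<open>pf_normalize\<close> below.\<close>

definition pf_vector :: "real^'x::finite^'x \<Rightarrow> real^'x" where
  "pf_vector A = (SOME v. (\<forall>x. 0 < v $ x) \<and> A *v v = pf_root A *s v)"

definition pf_normalize :: "real^'x::finite^'x \<Rightarrow> real^'x^'x" where
  "pf_normalize A =
    (\<chi> x x'. A $ x $ x' * pf_vector A $ x' / (pf_root A * pf_vector A $ x))"

text \<open>Positivity of \<open>Pt\<close> is explicit because \<^const>\<open>ln\<close> is total on the reals. The case
  \<open>k = 0\<close> is excluded by the condition that the coefficients sum to one.\<close>

definition e_hull :: "(real^'x::finite^'x) set \<Rightarrow> (real^'x^'x) set" where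
  "e_hull V = {pf_normalize Pt | Pt. positive_matrix Pt \<and>
     (\<exists>(k::nat) (\<alpha> :: nat \<Rightarrow> real) (P :: nat \<Rightarrow> real^'x^'x).
        (\<Sum>i=1..k. \<alpha> i) = 1 \<and> (\<forall>i\<in>{1..k}. P i \<in> V) \<and>
        map_matrix ln Pt = (\<Sum>i=1..k. \<alpha> i *\<^sub>R map_matrix ln (P i)))}"

end

theory Submission
  imports Defs
begin

text \<open>
  An affine combination of logarithms of symmetric kernels is the logarithm of a symmetric positive
  matrix \<open>A\<close>. With Perron--Frobenius vector \<open>v\<close>, the normalization of \<open>A\<close> satisfies detailed
  balance with respect to the weights \<open>v\<^sup>2\<close>.

  Conversely, if \<open>P\<close> is reversible with respect to \<open>\<pi>\<close>, it is the normalization of the symmetric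
  matrix \<open>S(x, x') = \<surd>\<pi>(x) P(x, x') / \<surd>\<pi>(x')\<close>, and of every positive multiple of \<open>S\<close>. As the uniform
  kernel contributes a constant matrix, it is enough that the logarithms of symmetric kernels
  linearly span the symmetric matrices. Perturb the uniform kernel by moving mass \<open>t/n\<close> from
  the diagonal entries at \<open>a\<close> and \<open>b\<close> to the entries \<open>(a, b)\<close> and \<open>(b, a)\<close>. Comparing
  \<open>t = 1/2\<close> with \<open>t = -1/2\<close> puts \<open>E\<^sub>a\<^sub>b + E\<^sub>b\<^sub>a\<close> and \<open>E\<^sub>a\<^sub>a + E\<^sub>b\<^sub>b\<close> into the span, and a
  third state separates \<open>E\<^sub>a\<^sub>a\<close> from \<open>E\<^sub>b\<^sub>b\<close>.
\<close>

section \<open>Perron--Frobenius theory of positive matrices\<close>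

lemma positive_matrix_vector_pos:
  fixes A :: "real^'x::finite^'x"
  assumes "positive_matrix A" "\<And>x. 0 \<le> v $ x" "v \<noteq> 0"
  shows "0 < (A *v v) $ x"
proof -
  obtain y where "v $ y \<noteq> 0"
    using assms(3) by (auto simp: vec_eq_iff)
  then have "0 < A $ x $ y * v $ y"
    using assms by (simp add: positive_matrix_def less_le)
  moreover have "0 \<le> A $ x $ z * v $ z" for z
    using assms by (simp add: positive_matrix_def less_imp_le)
  ultimately show ?thesis
    unfolding matrix_vector_mult_def by (auto intro!: sum_pos2)
qed

lemma positive_eigenvalue_pos:
  fixes A :: "real^'x::finite^'x"
  assumes "positive_matrix A" "\<And>x. 0 < v $ x" "A *v v = l *s v"
  shows "0 < l"
proof -
  have "v \<noteq> 0"
    using assms(2) by (metis less_irrefl zero_index)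
  \<comment> \<open>\<open>undefined\<close> stands for an arbitrary state: one positive entry of
    \<open>l *s v\<close> fixes the sign of \<open>l\<close>.\<close>
  then have "0 < (l *s v) $ undefined"
    using positive_matrix_vector_pos[OF assms(1), of v undefined] assms by (simp add: less_imp_le)
  then show ?thesis
    using assms(2)[of undefined] by (simp add: zero_less_mult_iff)
qed

text \<open>Brouwer's theorem on the probability simplex \<open>S\<close>: a fixed point of
  \<open>A *v v\<close> rescaled to total mass 1 is an eigenvector with eigenvalue
  \<open>s v\<close>, and it is positive because \<open>A\<close> sends all of \<open>S\<close> to
  positive vectors.\<close>

lemma positive_matrix_eigenvector:
  fixes A :: "real^'x::finite^'x"
  assumes A: "positive_matrix A"
  obtains l v where "\<And>x. 0 < v $ x" "A *v v = l *s v"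
proof -
  define S where "S = {v :: real^'x. (\<forall>x. 0 \<le> v $ x) \<and> (\<Sum>x\<in>UNIV. v $ x) = 1}"
  define s where "s v = (\<Sum>x\<in>UNIV. (A *v v) $ x)" for v
  have nz: "v \<noteq> 0" if "v \<in> S" for v
    using that by (auto simp: S_def)
  have pos: "0 < (A *v v) $ x" if "v \<in> S" for v x
    using positive_matrix_vector_pos[OF A _ nz[OF that]] that by (auto simp: S_def)
  have s_pos: "0 < s v" if "v \<in> S" for v
    unfolding s_def using pos[OF that] by (intro sum_pos) auto
  have "closed S"
  proof -
    have "S = (\<Inter>x. {v. 0 \<le> v $ x}) \<inter> {v. (\<Sum>x\<in>UNIV. v $ x) = 1}"
      by (auto simp: S_def)
    then show ?thesis
      by (auto intro!: closed_Int closed_INT closed_Collect_le closed_Collect_eq continuous_intros)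
  qed
  moreover have "bounded S"
  proof (rule boundedI)
    fix v assume "v \<in> S"
    then show "norm v \<le> 1"
      using norm_le_l1_cart[of v] by (simp add: S_def)
  qed
  ultimately have "compact S"
    by (simp add: compact_eq_bounded_closed)
  moreover have "convex S"
    by (rule convexI) (auto simp: S_def sum.distrib simp flip: sum_distrib_left)
  moreover have "S \<noteq> {}"
  proof -
    have "(\<chi> x. 1 / real CARD('x)) \<in> S"
      by (simp add: S_def)
    then show ?thesis by blast
  qed
  moreover have "continuous_on S (\<lambda>v. (1 / s v) *\<^sub>R (A *v v))"
    using s_pos unfolding s_def
    by (intro continuous_intros matrix_vector_mult_linear_continuous_on) force+
  moreover have "(\<lambda>v. (1 / s v) *\<^sub>R (A *v v)) \<in> S \<rightarrow> S"
  proof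
    fix v assume v: "v \<in> S"
    have "(\<Sum>x\<in>UNIV. (1 / s v) * (A *v v) $ x) = (1 / s v) * s v"
      by (simp only: s_def sum_distrib_left)
    then show "(1 / s v) *\<^sub>R (A *v v) \<in> S"
      using s_pos[OF v] pos[OF v] by (auto simp: S_def less_imp_le)
  qed
  ultimately obtain v where v: "v \<in> S" "(1 / s v) *\<^sub>R (A *v v) = v"
    by (rule brouwer)
  show ?thesis
  proof
    show "0 < v $ x" for x
    proof -
      have "0 < ((1 / s v) *\<^sub>R (A *v v)) $ x"
        using s_pos[OF v(1)] pos[OF v(1)] by simp
      then show ?thesis by (simp only: v(2))
    qed
    have "s v *\<^sub>R v = s v *\<^sub>R ((1 / s v) *\<^sub>R (A *v v))"
      by (simp only: v(2))
    then show "A *v v = s v *s v"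
      using s_pos[OF v(1)] by (simp add: scalar_mult_eq_scaleR)
  qed
qed

text \<open>The value \<open>l\<close> is attained on the spectrum by \<open>v\<close> read as a
  complex vector. For any other eigenvalue, the triangle inequality in the row where
  \<open>cmod (u $ x) / v $ x\<close> is largest bounds its modulus by \<open>l\<close>.\<close>

lemma pf_root_eqI:
  fixes A :: "real^'x::finite^'x"
  assumes A: "positive_matrix A" and v: "\<And>x. 0 < v $ x" and ev: "A *v v = l *s v"
  shows "pf_root A = l"
  unfolding pf_root_def
proof (rule cSup_eq_maximum)
  have ev': "(\<Sum>y\<in>UNIV. A $ x $ y * v $ y) = l * v $ x" for x
    using arg_cong[OF ev, of "\<lambda>w. w $ x"] by (simp add: matrix_vector_mult_def)
  have "map_matrix complex_of_real A *v (\<chi> x. of_real (v $ x)) = of_real l *s (\<chi> x. of_real (v $ x))"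
    by (simp add: vec_eq_iff matrix_vector_mult_def flip: of_real_mult of_real_sum ev')
  moreover have "(\<chi> x. complex_of_real (v $ x)) \<noteq> 0"
    using v by (auto simp: vec_eq_iff intro!: exI[of _ undefined] less_imp_neq[THEN not_sym])
  ultimately have "of_real l \<in> complex_spectrum A"
    unfolding complex_spectrum_def by blast
  moreover have "cmod (of_real l) = l"
    using positive_eigenvalue_pos[OF assms] by simp
  ultimately show "l \<in> cmod ` complex_spectrum A"
    by (metis imageI)
next
  fix r assume "r \<in> cmod ` complex_spectrum A"
  then obtain z u where z: "r = cmod z" "u \<noteq> 0" "map_matrix complex_of_real A *v u = z *s u"
    by (auto simp: complex_spectrum_def)
  define c where "c = (MAX x. cmod (u $ x) / v $ x)"
  have le: "cmod (u $ x) \<le> c * v $ x" for x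
  proof -
    have "cmod (u $ x) / v $ x \<le> c"
      unfolding c_def by (rule Max_ge) auto
    then show ?thesis
      using v[of x] by (simp add: field_simps)
  qed
  have "c \<in> range (\<lambda>x. cmod (u $ x) / v $ x)"
    unfolding c_def by (rule Max_in) auto
  then obtain x where "c = cmod (u $ x) / v $ x" by auto
  then have x: "cmod (u $ x) = c * v $ x"
    using v[of x] by simp
  obtain y where "u $ y \<noteq> 0"
    using z(2) by (auto simp: vec_eq_iff)
  then have "0 < c * v $ y"
    using le[of y] by (smt (verit) zero_less_norm_iff)
  then have "0 < c"
    using v[of y] by (simp add: zero_less_mult_iff)
  have "r * (c * v $ x) = cmod ((z *s u) $ x)"
    by (simp add: z(1) norm_mult x)
  also have "\<dots> = cmod (\<Sum>y\<in>UNIV. of_real (A $ x $ y) * u $ y)"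
    by (simp add: matrix_vector_mult_def flip: z(3))
  also have "\<dots> \<le> (\<Sum>y\<in>UNIV. A $ x $ y * (c * v $ y))"
    using A le by (intro sum_norm_le)
      (simp add: norm_mult positive_matrix_def less_imp_le mult_left_mono)
  also have "\<dots> = l * (c * v $ x)"
    using arg_cong[OF ev, of "\<lambda>w. c * w $ x"]
    by (simp add: matrix_vector_mult_def sum_distrib_left mult_ac)
  finally show "r \<le> l"
    using \<open>0 < c\<close> v[of x] by simp
qed

lemma pf_vector_props:
  fixes A :: "real^'x::finite^'x"
  assumes "positive_matrix A"
  shows "0 < pf_vector A $ x" "A *v pf_vector A = pf_root A *s pf_vector A"
proof -
  obtain l v where v: "\<And>x. 0 < v $ x" "A *v v = l *s v"
    using positive_matrix_eigenvector[OF assms] by blast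
  then have "(\<forall>x. 0 < v $ x) \<and> A *v v = pf_root A *s v"
    using pf_root_eqI[OF assms v] by simp
  from someI[of "\<lambda>v. (\<forall>x. 0 < v $ x) \<and> A *v v = pf_root A *s v", OF this]
  show "0 < pf_vector A $ x" "A *v pf_vector A = pf_root A *s pf_vector A"
    unfolding pf_vector_def by auto
qed

lemma pf_root_pos: "positive_matrix A \<Longrightarrow> 0 < pf_root A"
  by (rule positive_eigenvalue_pos[OF _ pf_vector_props])

text \<open>Subtract from \<open>u\<close> the largest multiple of \<open>v\<close> that stays below
  it. The difference \<open>w\<close> is nonnegative, satisfies the eigenvector equation and
  vanishes at some \<open>x\<close>; were it nonzero, \<open>A *v w\<close> would be positive at
  \<open>x\<close>.\<close>

lemma positive_eigenvector_unique:
  fixes A :: "real^'x::finite^'x"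
  assumes A: "positive_matrix A"
    and u: "\<And>x. 0 < u $ x" "A *v u = l *s u"
    and v: "\<And>x. 0 < v $ x" "A *v v = l *s v"
  obtains c where "0 < c" "u = c *s v"
proof -
  define c where "c = (MIN x. u $ x / v $ x)"
  define w where "w = u - c *s v"
  have "c \<in> range (\<lambda>x. u $ x / v $ x)"
    unfolding c_def by (rule Min_in) auto
  then obtain x where x: "c = u $ x / v $ x" by auto
  have "0 \<le> w $ y" for y
  proof -
    have "c \<le> u $ y / v $ y"
      unfolding c_def by (rule Min_le) auto
    then show ?thesis
      using v(1)[of y] by (simp add: w_def field_simps)
  qed
  moreover have "(A *v w) $ x = 0"
  proof -
    have "A *v w = l *s w"
      by (simp add: w_def matrix_vector_mult_diff_distrib u(2) v(2) vector_scalar_commute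
          vector_ssub_ldistrib vector_smult_assoc mult.commute)
    moreover have "w $ x = 0"
      using v(1)[of x] by (simp add: w_def x)
    ultimately show ?thesis by simp
  qed
  ultimately have "w = 0"
    using positive_matrix_vector_pos[OF A, of w x] by force
  moreover have "0 < c"
    using u(1)[of x] v(1)[of x] by (simp add: x)
  ultimately show ?thesis
    by (intro that[of c]) (simp_all add: w_def)
qed

text \<open>Makes the choice in \<open>pf_vector\<close> harmless: a scalar factor of the
  eigenvector cancels in the quotient, so any positive eigenvector may be used.\<close>

lemma pf_normalize_eq:
  fixes A :: "real^'x::finite^'x"
  assumes A: "positive_matrix A" and v: "\<And>x. 0 < v $ x" "A *v v = l *s v"
  shows "pf_normalize A = (\<chi> x x'. A $ x $ x' * v $ x' / (l * v $ x))"
proof -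
  have l: "pf_root A = l"
    using pf_root_eqI[OF A v] .
  obtain c where c: "0 < c" "pf_vector A = c *s v"
    using positive_eigenvector_unique[OF A pf_vector_props[OF A]] v l by metis
  show ?thesis
    using c(1) by (simp add: pf_normalize_def l c(2) vec_eq_iff)
qed

section \<open>Normalization of symmetric matrices\<close>

text \<open>Detailed balance survives scaling the weights to total mass 1, and summing it over one
  state gives stationarity.\<close>

lemma reversibleI:
  fixes P :: "real^'x::finite^'x"
  assumes P: "P \<in> kernels" and w: "\<And>x. 0 < w x"
    and db: "\<And>x x'. w x * P $ x $ x' = w x' * P $ x' $ x"
  shows "reversible P"
proof -
  define s where "s = (\<Sum>x\<in>UNIV. w x)"
  have s: "0 < s"
    unfolding s_def using w by (intro sum_pos) auto
  define p :: "real^'x" where "p = (\<chi> x. w x / s)"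
  have db': "p $ x * P $ x $ x' = p $ x' * P $ x' $ x" for x x'
    using db[of x x'] by (simp add: p_def)
  have "(\<Sum>y\<in>UNIV. P $ y $ x * p $ y) = p $ x" for x
  proof -
    have "(\<Sum>y\<in>UNIV. P $ y $ x * p $ y) = (\<Sum>y\<in>UNIV. p $ x * P $ x $ y)"
      by (simp add: db'[of x] mult.commute)
    also have "\<dots> = p $ x"
      using P by (simp add: kernels_def flip: sum_distrib_left)
    finally show ?thesis .
  qed
  then have "p v* P = p"
    by (simp add: vector_matrix_mult_def vec_eq_iff mult.commute)
  moreover have "(\<Sum>x\<in>UNIV. p $ x) = 1"
    using s by (simp add: p_def flip: sum_divide_distrib s_def)
  ultimately have "is_stationary P p"
    using w s by (simp add: is_stationary_def p_def less_imp_le)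
  then show ?thesis
    using db' unfolding reversible_def by blast
qed

lemma pf_normalize_symmetric:
  fixes A :: "real^'x::finite^'x"
  assumes A: "positive_matrix A" and sym: "\<And>x x'. A $ x $ x' = A $ x' $ x"
  shows "pf_normalize A \<in> rev_kernels"
proof -
  define v where "v = pf_vector A"
  define l where "l = pf_root A"
  have v: "0 < v $ x" for x
    using pf_vector_props[OF A] by (simp add: v_def)
  have l: "0 < l"
    using pf_root_pos[OF A] by (simp add: l_def)
  have ev: "(\<Sum>y\<in>UNIV. A $ x $ y * v $ y) = l * v $ x" for x
    using pf_vector_props(2)[OF A]
    by (simp add: vec_eq_iff matrix_vector_mult_def v_def l_def)
  have nth: "pf_normalize A $ x $ y = A $ x $ y * v $ y / (l * v $ x)" for x y
    by (simp add: pf_normalize_def v_def l_def)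
  have "pf_normalize A \<in> kernels"
    using A v l v[THEN less_imp_neq] unfolding kernels_def positive_matrix_def
    by (auto simp: nth ev simp flip: sum_divide_distrib)
  moreover have "reversible (pf_normalize A)"
  proof (rule reversibleI[where w = "\<lambda>x. (v $ x)\<^sup>2"])
    \<comment> \<open>The left side is \<open>A $ x $ y * v $ x * v $ y / l\<close>, which is
      symmetric in \<open>x\<close> and \<open>y\<close>.\<close>
    show "(v $ x)\<^sup>2 * pf_normalize A $ x $ y = (v $ y)\<^sup>2 * pf_normalize A $ y $ x" for x y
      using v[of x] v[of y] l by (simp add: nth sym[of x y] power2_eq_square field_simps)
  qed (use calculation v in \<open>auto simp: less_imp_neq[THEN not_sym]\<close>)
  ultimately show ?thesis
    by (simp add: rev_kernels_def)
qed

text \<open>Conjugation by the square roots of the stationary weights turns detailed balance into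
  symmetry, and the vector of these roots is an eigenvector of \<open>S\<close> with eigenvalue 1.
  The free factor \<open>c\<close> later absorbs an additive constant in the logarithms.\<close>

lemma reversible_pf_normalize_symmetric:
  fixes P :: "real^'x::finite^'x"
  assumes "P \<in> rev_kernels"
  obtains S where "positive_matrix S" "\<And>x x'. S $ x $ x' = S $ x' $ x"
    "\<And>c. 0 < c \<Longrightarrow> pf_normalize (c *\<^sub>R S) = P"
proof -
  have P: "0 < P $ x $ y" "(\<Sum>y\<in>UNIV. P $ x $ y) = 1" for x y
    using assms by (auto simp: rev_kernels_def kernels_def positive_matrix_def)
  obtain p where p: "is_stationary P p" and db: "\<And>x y. p $ x * P $ x $ y = p $ y * P $ y $ x"
    using assms by (auto simp: rev_kernels_def reversible_def)
  \<comment> \<open>Stationarity only provides nonnegative weights; they are positive because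
    \<open>p\<close> is its own image under the positive matrix \<open>transpose P\<close>.\<close>
  have "0 < (transpose P *v p) $ x" for x
  proof (rule positive_matrix_vector_pos)
    show "p \<noteq> 0" using p by (auto simp: is_stationary_def)
  qed (use P p in \<open>auto simp: positive_matrix_def transpose_def is_stationary_def\<close>)
  then have p_pos: "0 < p $ x" for x
    using p by (simp add: is_stationary_def)
  define v :: "real^'x" where "v = (\<chi> x. sqrt (p $ x))"
  have v: "0 < v $ x" "v $ x * v $ x = p $ x" for x
    using p_pos[of x] by (auto simp: v_def)
  define S :: "real^'x^'x" where "S = (\<chi> x y. v $ x * P $ x $ y / v $ y)"
  have S_nth: "S $ x $ y = v $ x * P $ x $ y / v $ y" for x y
    by (simp add: S_def)
  show ?thesis
  proof
    show S: "positive_matrix S"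
      using P v by (simp add: positive_matrix_def S_nth)
    show "S $ x $ y = S $ y $ x" for x y
    proof -
      have "v $ x * P $ x $ y * v $ x = v $ y * P $ y $ x * v $ y"
        using db[of x y] v(2)[of x] v(2)[of y] by (metis mult.assoc mult.commute)
      then show ?thesis
        using v(1)[of x] v(1)[of y] by (simp add: S_nth frac_eq_eq)
    qed
    show "pf_normalize (c *\<^sub>R S) = P" if c: "0 < c" for c
    proof -
      have "(\<Sum>y\<in>UNIV. c * S $ x $ y * v $ y) = c * v $ x" for x
      proof -
        have "(\<Sum>y\<in>UNIV. c * S $ x $ y * v $ y) = (\<Sum>y\<in>UNIV. c * v $ x * P $ x $ y)"
          using v(1)[THEN less_imp_neq] by (intro sum.cong) (auto simp: S_nth)
        then show ?thesis
          by (simp add: P flip: sum_distrib_left)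
      qed
      then have "(c *\<^sub>R S) *v v = c *s v"
        by (simp add: vec_eq_iff matrix_vector_mult_def)
      moreover have "positive_matrix (c *\<^sub>R S)"
        using S c by (simp add: positive_matrix_def)
      ultimately have "pf_normalize (c *\<^sub>R S) =
          (\<chi> x y. (c *\<^sub>R S) $ x $ y * v $ y / (c * v $ x))"
        using v(1) by (intro pf_normalize_eq)
      also have "\<dots> = P"
        using c v(1)[THEN less_imp_neq] by (auto simp: vec_eq_iff S_nth)
      finally show ?thesis .
    qed
  qed
qed

section \<open>The span of the logarithms of symmetric kernels\<close>

definition matrix_unit :: "'x \<Rightarrow> 'x \<Rightarrow> real^'x::finite^'x" where
  "matrix_unit a b = (\<chi> x y. if x = a \<and> y = b then 1 else 0)"

lemma sym_kernels_iff:
  "P \<in> sym_kernels \<longleftrightarrow> (\<forall>x y. 0 < P $ x $ y) \<and> (\<forall>x. (\<Sum>y\<in>UNIV. P $ x $ y) = 1) \<and>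
    (\<forall>x y. P $ x $ y = P $ y $ x)"
  unfolding sym_kernels_def kernels_def positive_matrix_def transpose_def mem_Collect_eq vec_eq_iff
    vec_lambda_beta by blast

lemma uniform_kernel_sym: "(\<chi> x y. 1 / real CARD('x)) \<in> (sym_kernels :: (real^'x::finite^'x) set)"
  by (simp add: sym_kernels_iff)

text \<open>The logarithm of the uniform kernel is a constant matrix, and it is nonzero once there
  are two states.\<close>

lemma constant_matrix_in_span_ln_sym_kernels:
  assumes "CARD('x::finite) \<ge> 2"
  shows "(\<chi> x y. c) \<in> span (map_matrix ln ` (sym_kernels :: (real^'x^'x) set))"
proof -
  let ?U = "map_matrix ln (\<chi> x y. 1 / real CARD('x)) :: real^'x^'x"
  have "ln (1 / real CARD('x)) < 0"
    using assms by simp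
  then have "(\<chi> x y. c) = (c / ln (1 / real CARD('x))) *\<^sub>R ?U"
    by (auto simp: vec_eq_iff)
  also have "\<dots> \<in> span (map_matrix ln ` sym_kernels)"
    by (intro span_scale span_base imageI uniform_kernel_sym)
  finally show ?thesis .
qed

lemma perturbed_uniform_in_span_ln_sym_kernels:
  fixes a b :: "'x::finite"
  assumes ab: "a \<noteq> b" and t: "\<bar>t\<bar> < 1"
  shows "ln (1 + t) *\<^sub>R (matrix_unit a b + matrix_unit b a) +
    ln (1 - t) *\<^sub>R (matrix_unit a a + matrix_unit b b)
    \<in> span (map_matrix ln ` (sym_kernels :: (real^'x^'x) set))" (is "?M \<in> _")
proof -
  let ?n = "real CARD('x)"
  \<comment> \<open>\<open>D\<close> has zero row sums and entries of modulus at most 1, so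
    \<open>P\<close> is a kernel for every \<open>t\<close> in the open interval from -1 to
    1.\<close>
  define D :: "real^'x^'x"
    where "D = matrix_unit a b + matrix_unit b a - matrix_unit a a - matrix_unit b b"
  define P :: "real^'x^'x" where "P = (\<chi> x y. (1 + t * D $ x $ y) / ?n)"
  have D_cases: "D $ x $ y \<in> {-1, 0, 1}" for x y
    using ab by (auto simp: D_def matrix_unit_def)
  have "(\<Sum>y\<in>UNIV. D $ x $ y) = 0" for x
    using ab by (cases "x = a"; cases "x = b")
      (simp_all add: D_def matrix_unit_def sum.distrib sum_subtractf)
  then have rows: "(\<Sum>y\<in>UNIV. P $ x $ y) = 1" for x
    by (simp add: P_def sum.distrib flip: sum_divide_distrib sum_distrib_left)
  have pos: "0 < 1 + t * D $ x $ y" for x y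
    using D_cases[of x y] t by auto
  have "D $ x $ y = D $ y $ x" for x y
    by (simp add: D_def matrix_unit_def conj_commute)
  then have "P \<in> sym_kernels"
    using rows pos by (simp add: sym_kernels_iff P_def)
  moreover have "CARD('x) \<ge> 2"
    using ab card_mono[of UNIV "{a, b}"] by simp
  ultimately have "map_matrix ln P - (\<chi> x y. ln (1 / ?n))
      \<in> span (map_matrix ln ` (sym_kernels :: (real^'x^'x) set))"
    by (intro span_diff span_base imageI constant_matrix_in_span_ln_sym_kernels)
  moreover have "map_matrix ln P - (\<chi> x y. ln (1 / ?n)) = ?M"
  proof -
    have "ln (P $ x $ y) - ln (1 / ?n) = ?M $ x $ y" for x y
    proof -
      have "ln (P $ x $ y) - ln (1 / ?n) = ln (1 + t * D $ x $ y)"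
        using pos[of x y] by (simp add: P_def ln_div)
      \<comment> \<open>As \<open>a \<noteq> b\<close>, the four matrix units have disjoint
        supports: \<open>D\<close> is 1 on the first pair, -1 on the second and 0 elsewhere, where
        the logarithm vanishes.\<close>
      also have "\<dots> = ?M $ x $ y"
        using ab by (auto simp: D_def matrix_unit_def)
      finally show ?thesis .
    qed
    then show ?thesis by (simp add: vec_eq_iff)
  qed
  ultimately show ?thesis by simp
qed

lemma matrix_unit_pairs_in_span_ln_sym_kernels:
  fixes a b :: "'x::finite"
  assumes ab: "a \<noteq> b"
  defines "V \<equiv> span (map_matrix ln ` (sym_kernels :: (real^'x^'x) set))"
  shows "matrix_unit a b + matrix_unit b a \<in> V" "matrix_unit a a + matrix_unit b b \<in> V"
proof -
  define E :: "real^'x^'x" where "E = matrix_unit a b + matrix_unit b a"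
  define F :: "real^'x^'x" where "F = matrix_unit a a + matrix_unit b b"
  define p q :: real where "p = ln (3/2)" and "q = ln (1/2)"
  have "p *\<^sub>R E + q *\<^sub>R F \<in> V" "q *\<^sub>R E + p *\<^sub>R F \<in> V"
    using perturbed_uniform_in_span_ln_sym_kernels[OF ab, of "1/2"]
      perturbed_uniform_in_span_ln_sym_kernels[OF ab, of "-1/2"]
    by (simp_all add: V_def E_def F_def p_def q_def)
  \<comment> \<open>Cramer's rule for the 2 by 2 system with rows \<open>(p, q)\<close> and
    \<open>(q, p)\<close>: the first combination eliminates \<open>F\<close>, the second
    \<open>E\<close>, each leaving the determinant as factor.\<close>
  then have "p *\<^sub>R (p *\<^sub>R E + q *\<^sub>R F) - q *\<^sub>R (q *\<^sub>R E + p *\<^sub>R F) \<in> V"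
    "p *\<^sub>R (q *\<^sub>R E + p *\<^sub>R F) - q *\<^sub>R (p *\<^sub>R E + q *\<^sub>R F) \<in> V"
    unfolding V_def by (blast intro: span_diff span_scale)+
  then have "(p * p - q * q) *\<^sub>R E \<in> V" "(p * p - q * q) *\<^sub>R F \<in> V"
    by (simp_all add: algebra_simps)
  moreover have "p * p - q * q \<noteq> 0"
  proof -
    have "p + q = ln (3/4)" "p - q = ln 3"
      using ln_mult_pos[of "3/2" "1/2 :: real"] ln_div[of "3/2" "1/2 :: real"]
      by (simp_all add: p_def q_def)
    then have "(p + q) * (p - q) \<noteq> 0" by simp
    then show ?thesis by (simp add: algebra_simps)
  qed
  ultimately have "E \<in> V" "F \<in> V"
    using span_scale[of _ _ "1 / (p * p - q * q)"] unfolding V_def by fastforce+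
  then show "matrix_unit a b + matrix_unit b a \<in> V" "matrix_unit a a + matrix_unit b b \<in> V"
    by (simp_all only: E_def F_def)
qed

lemma symmetric_in_span_ln_sym_kernels:
  fixes M :: "real^'x::finite^'x"
  assumes card: "CARD('x) \<ge> 3" and sym: "\<And>x y. M $ x $ y = M $ y $ x"
  shows "M \<in> span (map_matrix ln ` sym_kernels)" (is "_ \<in> ?V")
proof -
  have diag: "matrix_unit a a \<in> ?V" for a :: 'x
  proof -
    \<comment> \<open>Here three states matter: a symmetric kernel on two states has equal diagonal
      entries, so the logarithms could not separate the diagonal positions.\<close>
    obtain b c where bc: "a \<noteq> b" "a \<noteq> c" "b \<noteq> c"
    proof -
      have "card (UNIV - {a}) \<ge> 2" using card by (simp add: card_Diff_subset)
      then obtain T where "T \<subseteq> UNIV - {a}" "card T = 2"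
        by (meson obtain_subset_with_card_n)
      then show ?thesis using that by (auto simp: card_2_iff)
    qed
    let ?d = "\<lambda>x. matrix_unit x x :: real^'x^'x"
    have "(1/2) *\<^sub>R ((?d a + ?d b) + (?d a + ?d c) - (?d b + ?d c)) \<in> ?V"
      by (intro span_scale span_diff span_add matrix_unit_pairs_in_span_ln_sym_kernels bc)
    moreover have "(1/2) *\<^sub>R ((?d a + ?d b) + (?d a + ?d c) - (?d b + ?d c)) = ?d a"
      by (simp add: vec_eq_iff)
    ultimately show ?thesis by simp
  qed
  have pair: "matrix_unit a b + matrix_unit b a \<in> ?V" for a b :: 'x
    using matrix_unit_pairs_in_span_ln_sym_kernels(1)[of a b] span_add[OF diag[of a] diag[of a]]
    by (cases "a = b") (simp_all only: not_False_eq_True)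
  \<comment> \<open>The sum is the symmetric part of \<open>M\<close>, half of \<open>M\<close> plus
    its transpose, and hence \<open>M\<close> itself.\<close>
  have "(\<Sum>a\<in>UNIV. \<Sum>b\<in>UNIV. (M $ a $ b / 2) *\<^sub>R (matrix_unit a b + matrix_unit b a)) \<in> ?V"
    by (intro span_sum span_scale pair)
  moreover have "(\<Sum>a\<in>UNIV. \<Sum>b\<in>UNIV. (M $ a $ b / 2) *\<^sub>R (matrix_unit a b + matrix_unit b a)) = M"
    unfolding vec_eq_iff
  proof (intro allI)
    fix x y
    have "(\<Sum>a\<in>UNIV. \<Sum>b\<in>UNIV. (M $ a $ b / 2) *\<^sub>R (matrix_unit a b + matrix_unit b a)) $ x $ y
      = (\<Sum>a\<in>UNIV. \<Sum>b\<in>UNIV. if x = a then (if y = b then M $ a $ b / 2 else 0) else 0)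
      + (\<Sum>a\<in>UNIV. \<Sum>b\<in>UNIV. if y = a then (if x = b then M $ a $ b / 2 else 0) else 0)"
      unfolding sum.distrib[symmetric]
      by (simp, intro sum.cong refl) (auto simp: matrix_unit_def)
    also have "\<dots> = M $ x $ y / 2 + M $ y $ x / 2"
      by (simp add: if_distrib[of "sum _"] sum.If_cases)
    finally show "(\<Sum>a\<in>UNIV. \<Sum>b\<in>UNIV.
        (M $ a $ b / 2) *\<^sub>R (matrix_unit a b + matrix_unit b a)) $ x $ y = M $ x $ y"
      using sym[of x y] by simp
  qed
  ultimately show ?thesis
    by (simp only:)
qed

section \<open>From the linear span to affine combinations\<close>

lemma span_image_sum:
  assumes "M \<in> span (f ` V)"
  obtains k :: nat and r :: "nat \<Rightarrow> real" and P
    where "\<forall>i\<in>{1..k}. P i \<in> V" "M = (\<Sum>i=1..k. r i *\<^sub>R f (P i))"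
proof -
  obtain T r where T: "finite T" "T \<subseteq> f ` V" "M = (\<Sum>a\<in>T. r a *\<^sub>R a)"
    using assms by (auto simp: span_explicit)
  obtain h where h: "bij_betw h {1..card T} T"
    using ex_bij_betw_nat_finite_1[OF T(1)] by blast
  \<comment> \<open>The span yields a finite set of values of \<open>f\<close>;
    \<open>e_hull\<close> asks for a family indexed from 1 to \<open>k\<close>, so the values are
    enumerated by \<open>h\<close> and preimages are chosen.\<close>
  have "\<forall>i\<in>{1..card T}. \<exists>p\<in>V. h i = f p"
    using T(2) bij_betwE[OF h] by blast
  then obtain P where P: "\<And>i. i \<in> {1..card T} \<Longrightarrow> P i \<in> V \<and> h i = f (P i)"
    by metis
  have "M = (\<Sum>i=1..card T. r (h i) *\<^sub>R h i)"
    unfolding T(3) by (rule sum.reindex_bij_betw[OF h, symmetric])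
  also have "\<dots> = (\<Sum>i=1..card T. r (h i) *\<^sub>R f (P i))"
    using P by (intro sum.cong) auto
  finally show ?thesis
    using P by (intro that[of "card T" P "\<lambda>i. r (h i)"]) auto
qed

lemma symmetric_affine_combination:
  fixes M :: "real^'x::finite^'x"
  assumes "CARD('x) \<ge> 3" "\<And>x y. M $ x $ y = M $ y $ x"
  obtains c and k :: nat and \<alpha> :: "nat \<Rightarrow> real" and P
    where "(\<Sum>i=1..k. \<alpha> i) = 1" "\<forall>i\<in>{1..k}. P i \<in> sym_kernels"
      "M + (\<chi> x y. c) = (\<Sum>i=1..k. \<alpha> i *\<^sub>R map_matrix ln (P i))"
proof -
  obtain k r P where P: "\<forall>i\<in>{1..k::nat}. P i \<in> sym_kernels"
    and M: "M = (\<Sum>i=1..k. r i *\<^sub>R map_matrix ln (P i))"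
    by (rule span_image_sum[OF symmetric_in_span_ln_sym_kernels[OF assms]])
  define U :: "real^'x^'x" where "U = (\<chi> x y. 1 / real CARD('x))"
  \<comment> \<open>The uniform kernel, appended at index \<open>Suc k\<close> with the missing
    weight \<open>d\<close>, makes the coefficients sum to 1 and shifts \<open>M\<close> only by a
    constant.\<close>
  define d where "d = 1 - (\<Sum>i=1..k. r i)"
  have "M + (\<chi> x y. d * ln (1 / real CARD('x))) = M + d *\<^sub>R map_matrix ln U"
    by (simp add: vec_eq_iff U_def)
  also have "\<dots> = (\<Sum>i=1..Suc k. (r(Suc k := d)) i *\<^sub>R map_matrix ln ((P(Suc k := U)) i))"
    by (simp add: M)
  finally show ?thesis
    using P uniform_kernel_sym
    by (intro that[of "r(Suc k := d)" "Suc k" "P(Suc k := U)"])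
      (auto simp: d_def U_def le_Suc_eq)
qed

section \<open>The two inclusions\<close>

theorem theorem9p1:
  assumes "CARD('x::finite) \<ge> 3"
  shows "e_hull sym_kernels = (rev_kernels :: (real^'x^'x) set)"
proof
  show "e_hull sym_kernels \<subseteq> (rev_kernels :: (real^'x^'x) set)"
  proof
    fix K :: "real^'x^'x" assume "K \<in> e_hull sym_kernels"
    then obtain A k \<alpha> P where K: "K = pf_normalize A" and A: "positive_matrix A"
      and P: "\<forall>i\<in>{1..k::nat}. P i \<in> sym_kernels"
      and ln_A: "map_matrix ln A = (\<Sum>i=1..k. \<alpha> i *\<^sub>R map_matrix ln (P i))"
      by (auto simp: e_hull_def)
    have P_sym: "P i $ x $ y = P i $ y $ x" if "i \<in> {1..k}" for i x y
      using P that unfolding sym_kernels_iff by blast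
    have "ln (A $ x $ y) = (\<Sum>i=1..k. \<alpha> i * ln (P i $ x $ y))" for x y
      using arg_cong[OF ln_A, of "\<lambda>M. M $ x $ y"] by simp
    then have "ln (A $ x $ y) = ln (A $ y $ x)" for x y
      by (simp only:) (intro sum.cong refl arg_cong2[where f = "(*)"] arg_cong[where f = ln] P_sym)
    then have "A $ x $ y = A $ y $ x" for x y
      using A by (metis positive_matrix_def ln_inj_iff)
    then show "K \<in> rev_kernels"
      unfolding K by (rule pf_normalize_symmetric[OF A])
  qed
next
  show "(rev_kernels :: (real^'x^'x) set) \<subseteq> e_hull sym_kernels"
  proof
    fix K :: "real^'x^'x" assume "K \<in> rev_kernels"
    then obtain S where S: "positive_matrix S" "\<And>x y. S $ x $ y = S $ y $ x"
      and K: "\<And>c. 0 < c \<Longrightarrow> pf_normalize (c *\<^sub>R S) = K"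
      by (rule reversible_pf_normalize_symmetric) blast
    have "map_matrix ln S $ x $ y = map_matrix ln S $ y $ x" for x y
      using S(2)[of x y] by simp
    then obtain c k \<alpha> P where \<alpha>: "(\<Sum>i=1..k::nat. \<alpha> i) = 1" "\<forall>i\<in>{1..k}. P i \<in> sym_kernels"
      and eq: "map_matrix ln S + (\<chi> x y. c) = (\<Sum>i=1..k. \<alpha> i *\<^sub>R map_matrix ln (P i))"
      by (rule symmetric_affine_combination[OF assms])
    \<comment> \<open>The additive constant \<open>c\<close> becomes the factor \<open>exp c\<close>
      on \<open>S\<close>, which normalization removes by \<open>K\<close>.\<close>
    have "map_matrix ln (exp c *\<^sub>R S) = map_matrix ln S + (\<chi> x y. c)"
      using S(1) by (simp add: vec_eq_iff positive_matrix_def ln_mult_pos add.commute)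
    moreover have "positive_matrix (exp c *\<^sub>R S)"
      using S(1) by (simp add: positive_matrix_def)
    ultimately have "pf_normalize (exp c *\<^sub>R S) \<in> e_hull sym_kernels"
      using \<alpha> eq unfolding e_hull_def by auto
    then show "K \<in> e_hull sym_kernels"
      by (simp add: K)
  qed
qed

end
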